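(* Let $X$ be a real Banach space, let $\mathcal V\subseteq X$ be an open neighbourhood of zero and let $\mathcal E\subset\mathcal V$ be an $m$-dimensional $C^2$-manifold containing zero. Let $\mathcal E$ be parametrized by an injective map $\psi:U\subset\mathbb R^m\to\mathcal E$ with $\psi(0)=0$, where $\psi'(0)$ has full rank $m$. Assume that $T:\mathcal V\to X$ is continuous, that $T(u)=u$ for $u\in\mathcal E$, and that there is $M\in\mathscr L(X)$ with spectral radius greater than one such that, for some $\sigma>1$, $$\|T(u)-Mu\|=\mathcal O(\|u\|^\sigma)\qquad\text{as }u\to0.$$ Suppose further that $\partial_1\psi(0),\dots,\partial_m\psi(0)\in\ker(M-\mathrm{id})$. Then $u_*=0$ is orbitally unstable with respect to $\mathcal E$ under iterations of $T$. More precisely, there is $\varepsilon_0>0$ such that for each $\delta>0$ there are $u_\delta\in\mathcal V$ with $\|u_\delta\|\le\delta$ and $N\in\mathbb N$ such that $T^n(u_\delta)\in\mathcal V$ for $n=1,\dots,N$ and $\mathrm{dist}(T^N(u_\delta),\mathcal E)\ge\varepsilon_0$.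
   Context: $\mathscr L(X)$ denotes the bounded linear operators on $X$; the spectrum and spectral radius of $M$ are those of its complexification. "$C^2$-manifold parametrized by $\psi$" means: $U\subset\mathbb R^m$ is an open neighbourhood of $0$, $\psi$ is of class $C^2$ as a map into $X$, $\psi(U)=\mathcal E$, and $\mathcal E$ is an embedded submanifold of $X$ (so $\psi$ is a homeomorphism onto $\mathcal E$). *)

theory Defs
  imports "HOL-Analysis.Analysis" "HOL-Library.Landau_Symbols"
begin

text \<open>The complexification of a real normed space \<open>X\<close> is \<open>X \<times> X\<close>, where \<open>(x, y)\<close>
  stands for \<open>x + \<i> y\<close>. The product norm need not be homogeneous for complex scalars, but it is
  equivalent to every usual complexification norm, so boundedness is not affected by this choice.\<close>

definition cscale :: "complex \<Rightarrow> 'a::real_vector \<times> 'a \<Rightarrow> 'a \<times> 'a" where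
  "cscale z p = (Re z *\<^sub>R fst p - Im z *\<^sub>R snd p, Im z *\<^sub>R fst p + Re z *\<^sub>R snd p)"

definition complexify :: "('a::real_normed_vector \<Rightarrow>\<^sub>L 'a) \<Rightarrow> 'a \<times> 'a \<Rightarrow> 'a \<times> 'a" where
  "complexify M p = (blinfun_apply M (fst p), blinfun_apply M (snd p))"

definition complex_spectrum :: "('a::real_normed_vector \<Rightarrow>\<^sub>L 'a) \<Rightarrow> complex set" where
  "complex_spectrum M =
    {z. \<not> (\<exists>R :: 'a \<times> 'a \<Rightarrow> 'a \<times> 'a.
            bounded_linear R \<and> (\<forall>c p. R (cscale c p) = cscale c (R p)) \<and>
            (\<forall>p. R (cscale z p - complexify M p) = p) \<and>
            (\<forall>p. cscale z (R p) - complexify M (R p) = p))}"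

text \<open>The supremum is taken in \<^typ>\<open>ennreal\<close>, so that it is \<open>0\<close> on the zero space, where the
  spectrum is empty.\<close>

definition spectral_radius :: "('a::real_normed_vector \<Rightarrow>\<^sub>L 'a) \<Rightarrow> ennreal" where
  "spectral_radius M = (SUP z\<in>complex_spectrum M. ennreal (cmod z))"

text \<open>To be used for open \<open>S\<close>.\<close>

definition C2_on :: "('a::real_normed_vector \<Rightarrow> 'b::real_normed_vector) \<Rightarrow> 'a set \<Rightarrow> bool" where
  "C2_on f S \<longleftrightarrow>
    (\<exists>(f' :: 'a \<Rightarrow> ('a \<Rightarrow>\<^sub>L 'b)) (f'' :: 'a \<Rightarrow> ('a \<Rightarrow>\<^sub>L ('a \<Rightarrow>\<^sub>L 'b))).
      (\<forall>x\<in>S. (f has_derivative blinfun_apply (f' x)) (at x) \<and>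
              (f' has_derivative blinfun_apply (f'' x)) (at x)) \<and>
      continuous_on S f'')"

text \<open>Embedded \<open>m\<close>-dimensional \<open>C\<^sup>2\<close>-submanifold: around each of its points, \<open>E\<close> is straightened
  to an \<open>m\<close>-dimensional subspace by a \<open>C\<^sup>2\<close>-diffeomorphism between open sets of the ambient space.
  Finite-dimensional subspaces of normed spaces are complemented, so no splitting condition is
  needed. The definition is meant for \<open>m \<ge> 1\<close>, since \<^const>\<open>dim\<close> is \<open>0\<close> on infinite-dimensional
  subspaces.\<close>

definition C2_submanifold :: "nat \<Rightarrow> 'a::real_normed_vector set \<Rightarrow> bool" where
  "C2_submanifold m E \<longleftrightarrow>
    (\<forall>p\<in>E. \<exists>W W' F (\<Phi> :: 'a \<Rightarrow> 'a) \<Phi>inv.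
      open W \<and> p \<in> W \<and> open W' \<and> homeomorphism W W' \<Phi> \<Phi>inv \<and>
      C2_on \<Phi> W \<and> C2_on \<Phi>inv W' \<and>
      subspace F \<and> dim F = m \<and> \<Phi> ` (E \<inter> W) = F \<inter> W')"

text \<open>If \<open>\<psi>\<close> is injective, then it is automatically a homeomorphism onto \<open>E\<close>, by invariance of
  domain in the charts of \<open>E\<close>.\<close>

definition C2_parametrized_manifold ::
  "(real ^ 'm \<Rightarrow> 'a::real_normed_vector) \<Rightarrow> (real ^ 'm) set \<Rightarrow> 'a set \<Rightarrow> bool" where
  "C2_parametrized_manifold \<psi> U E \<longleftrightarrow>
    open U \<and> 0 \<in> U \<and> C2_on \<psi> U \<and> \<psi> ` U = E \<and> C2_submanifold CARD('m) E"

definition partial_derivative ::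
  "'m \<Rightarrow> (real ^ 'm \<Rightarrow> 'a::real_normed_vector) \<Rightarrow> real ^ 'm \<Rightarrow> 'a" where
  "partial_derivative i \<psi> x = vector_derivative (\<lambda>t. \<psi> (x + t *\<^sub>R axis i 1)) (at 0)"

end

theory Submission imports Defs "HOL-Real_Asymp.Real_Asymp" begin

text \<open>
  Why the theorem is true. Let \<open>r\<close> be the exponential growth rate of \<open>norm (M^n)\<close>, the infimum of all
  \<open>t\<close> with \<open>norm (M^n) = O(t^n)\<close>. A Neumann series for the resolvent shows that the spectrum lies in
  the closed disc of radius \<open>r\<close>, so \<open>r > 1\<close>. Choose \<open>1 < s < r < t < s powr \<sigma>\<close>.

  Instead of approximate eigenvectors, the proof uses record times. Since \<open>norm (M^n) / s^n\<close> is
  unbounded, there are arbitrarily late times \<open>N + 1\<close> at which it is maximal so far. A vector that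
  \<open>M^(N + 1)\<close> stretches by almost \<open>norm (M^(N + 1))\<close>, scaled to \<open>u\<close> with
  \<open>norm (M^(N + 1) u) = a\<close>, then has a linear orbit that obeys the backward decay
  \<open>norm (M^n u) \<le> a * s^n / s^N\<close> and still grows by a factor greater than 1 in the last step, so that
  \<open>norm ((M - id) (M^N u)) \<ge> c * a\<close>. The size \<open>a\<close> is prescribed, and \<open>u\<close> is as small as desired
  when \<open>N\<close> is large (\<open>amplified_initial_vector\<close>).

  By variation of constants, the orbit of \<open>u\<close> under \<open>T\<close> differs from the linear one at time \<open>n\<close> by at
  most a constant times \<open>(a * s^n / s^N) powr \<sigma>\<close>: the remainders are of this order, and they grow
  faster than the rate \<open>t\<close> at which \<open>M\<close> propagates them, because \<open>t < s powr \<sigma>\<close>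
  (\<open>iterates_shadow_linearization\<close>). So \<open>w = T^N u\<close> satisfies \<open>norm ((M - id) w) \<ge> c * a - O(a powr \<sigma>)\<close>.

  The map \<open>M - id\<close> also separates \<open>w\<close> from \<open>E\<close>. A fixed point \<open>p\<close> of \<open>T\<close> satisfies
  \<open>(M - id) p = M p - T p = O(norm p powr \<sigma>)\<close>, which says quantitatively that near zero \<open>E\<close> lies close
  to the kernel of \<open>M - id\<close>. For \<open>p\<close> in \<open>E\<close> of size at most \<open>4 * a\<close> this gives
  \<open>norm ((M - id) (w - p)) \<ge> c * a - O(a powr \<sigma>)\<close>, hence a lower bound for \<open>norm (w - p)\<close>, while larger
  \<open>p\<close> are far from \<open>w\<close> anyway. A fixed small \<open>a\<close> makes the bound positive, independently of \<open>\<delta>\<close>.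
\<close>

section \<open>Powers of a bounded operator and its spectral radius\<close>

primrec blinfun_power :: "('a::real_normed_vector \<Rightarrow>\<^sub>L 'a) \<Rightarrow> nat \<Rightarrow> 'a \<Rightarrow>\<^sub>L 'a" where
  "blinfun_power M 0 = id_blinfun"
| "blinfun_power M (Suc n) = M o\<^sub>L blinfun_power M n"

lemma blinfun_power_apply_commute:
  "blinfun_power M n (blinfun_apply M x) = M (blinfun_power M n x)"
  by (induction n) auto

lemma blinfun_power_Suc_right: "blinfun_power M (Suc n) = blinfun_power M n o\<^sub>L M"
  by (rule blinfun_eqI) (simp add: blinfun_power_apply_commute)

lemma norm_blinfun_power_le: "norm (blinfun_power M n) \<le> norm M ^ n"
proof (induction n)
  case 0
  then show ?case by (simp add: norm_blinfun_id_le)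
next
  case (Suc n)
  have "norm (blinfun_power M (Suc n)) \<le> norm M * norm (blinfun_power M n)"
    by (simp add: norm_blinfun_compose)
  also have "\<dots> \<le> norm M * norm M ^ n"
    using Suc by (intro mult_left_mono) auto
  finally show ?case by simp
qed

text \<open>The Neumann series \<open>(\<Sum>n. M^n / z^(n + 1))\<close> converges and inverts \<open>z - M\<close>. On the complexification
  its real part \<open>A\<close> and imaginary part \<open>B\<close> are operators on the real space, and the inverse acts like
  multiplication of \<open>x + \<i> y\<close> by \<open>A + \<i> B\<close>.\<close>

lemma bounded_powers_not_in_complex_spectrum:
  fixes M :: "'a::banach \<Rightarrow>\<^sub>L 'a"
  assumes bound: "\<And>n. norm (blinfun_power M n) \<le> K * t ^ n" and t: "0 < t" "t < cmod z"
  shows "z \<notin> complex_spectrum M"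
proof -
  have z0: "z \<noteq> 0" using t by auto
  define w where "w n = inverse (z ^ Suc n)" for n
  define P where "P = blinfun_power M"
  define A where "A = (\<Sum>n. Re (w n) *\<^sub>R P n)"
  define B where "B = (\<Sum>n. Im (w n) *\<^sub>R P n)"
  have zw: "z * w 0 = 1" "z * w (Suc n) = w n" for n
    using z0 by (auto simp: w_def)
  have geom: "summable (\<lambda>n. K / cmod z * (t / cmod z) ^ n)"
    using t by (intro summable_mult summable_geometric) (auto simp: divide_simps)
  have wP: "cmod (w n) * norm (P n) \<le> K / cmod z * (t / cmod z) ^ n" for n
  proof -
    have "cmod (w n) * norm (P n) \<le> cmod (w n) * (K * t ^ n)"
      unfolding P_def by (intro mult_left_mono bound) auto
    also have "\<dots> = K / cmod z * (t / cmod z) ^ n"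
      by (simp add: w_def norm_inverse norm_divide norm_power norm_mult field_simps)
    finally show ?thesis .
  qed
  have summ: "summable (\<lambda>n. c n *\<^sub>R P n)" if "\<And>n. \<bar>c n\<bar> \<le> cmod (w n)" for c
  proof (rule summable_comparison_test'[OF geom])
    fix n
    have "norm (c n *\<^sub>R P n) \<le> cmod (w n) * norm (P n)"
      using that[of n] by (simp add: mult_right_mono)
    then show "norm (c n *\<^sub>R P n) \<le> K / cmod z * (t / cmod z) ^ n"
      using wP[of n] by linarith
  qed
  have sA: "summable (\<lambda>n. Re (w n) *\<^sub>R P n)" and sB: "summable (\<lambda>n. Im (w n) *\<^sub>R P n)"
    by (intro summ abs_Re_le_cmod abs_Im_le_cmod)+
  have comp_r: "(\<Sum>n. c n *\<^sub>R P n) o\<^sub>L M = (\<Sum>n. c n *\<^sub>R P (Suc n))"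
    and comp_l: "M o\<^sub>L (\<Sum>n. c n *\<^sub>R P n) = (\<Sum>n. c n *\<^sub>R P (Suc n))"
    if "summable (\<lambda>n. c n *\<^sub>R P n)" for c
  proof -
    interpret r: bounded_linear "\<lambda>Q. Q o\<^sub>L M"
      by (rule bounded_bilinear.bounded_linear_left[OF bounded_bilinear_blinfun_compose])
    interpret l: bounded_linear "\<lambda>Q. M o\<^sub>L Q"
      by (rule bounded_bilinear.bounded_linear_right[OF bounded_bilinear_blinfun_compose])
    have eqs: "(c n *\<^sub>R P n) o\<^sub>L M = c n *\<^sub>R P (Suc n)" "M o\<^sub>L (c n *\<^sub>R P n) = c n *\<^sub>R P (Suc n)" for n
      by (simp_all add: r.scaleR l.scaleR P_def blinfun_power_Suc_right[symmetric]
          del: blinfun_power.simps(2)) simp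
    show "(\<Sum>n. c n *\<^sub>R P n) o\<^sub>L M = (\<Sum>n. c n *\<^sub>R P (Suc n))"
      using r.suminf[OF that] by (simp only: eqs)
    show "M o\<^sub>L (\<Sum>n. c n *\<^sub>R P n) = (\<Sum>n. c n *\<^sub>R P (Suc n))"
      using l.suminf[OF that] by (simp only: eqs)
  qed
  have comm: "A o\<^sub>L M = M o\<^sub>L A" "B o\<^sub>L M = M o\<^sub>L B"
    unfolding A_def B_def by (simp_all add: comp_r comp_l sA sB)
  \<comment> \<open>Real and imaginary part of the telescoping identity
    \<open>z * (\<Sum>n. w n * M^n) = 1 + (\<Sum>n. w n * M^(n + 1))\<close>.\<close>
  have re: "Re z *\<^sub>R A - Im z *\<^sub>R B = id_blinfun + (A o\<^sub>L M)"
  proof -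
    have s: "summable (\<lambda>n. Re (z * w n) *\<^sub>R P n)"
      using summable_diff[OF summable_scaleR_right[OF sA, of "Re z"]
          summable_scaleR_right[OF sB, of "Im z"]]
      by (simp add: scaleR_diff_left)
    have "Re z *\<^sub>R A - Im z *\<^sub>R B = (\<Sum>n. Re (z * w n) *\<^sub>R P n)"
      using suminf_diff[OF summable_scaleR_right[OF sA, of "Re z"]
          summable_scaleR_right[OF sB, of "Im z"]]
      by (simp add: A_def B_def suminf_scaleR_right sA sB scaleR_diff_left)
    also have "\<dots> = id_blinfun + (\<Sum>n. Re (w n) *\<^sub>R P (Suc n))"
      using suminf_split_head[OF s] by (simp add: zw P_def del: blinfun_power.simps(2) times_complex.sel)
    finally show ?thesis by (simp only: comp_r[OF sA, folded A_def])
  qed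
  have im: "Im z *\<^sub>R A + Re z *\<^sub>R B = B o\<^sub>L M"
  proof -
    have s: "summable (\<lambda>n. Im (z * w n) *\<^sub>R P n)"
      using summable_add[OF summable_scaleR_right[OF sB, of "Re z"]
          summable_scaleR_right[OF sA, of "Im z"]]
      by (simp add: scaleR_add_left)
    have "Im z *\<^sub>R A + Re z *\<^sub>R B = (\<Sum>n. Im (z * w n) *\<^sub>R P n)"
      using suminf_add[OF summable_scaleR_right[OF sB, of "Re z"]
          summable_scaleR_right[OF sA, of "Im z"]]
      by (simp add: A_def B_def suminf_scaleR_right sA sB scaleR_add_left add.commute)
    also have "\<dots> = (\<Sum>n. Im (w n) *\<^sub>R P (Suc n))"
      using suminf_split_head[OF s] by (simp add: zw P_def del: blinfun_power.simps(2) times_complex.sel)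
    finally show ?thesis by (simp only: comp_r[OF sB, folded B_def])
  qed
  have re': "Re z *\<^sub>R A x - Im z *\<^sub>R B x = x + A (M x)" for x
    using arg_cong[OF re, of "\<lambda>Q. blinfun_apply Q x"]
    by (simp add: blinfun.add_left blinfun.diff_left blinfun.scaleR_left)
  have im': "Im z *\<^sub>R A x + Re z *\<^sub>R B x = B (M x)" for x
    using arg_cong[OF im, of "\<lambda>Q. blinfun_apply Q x"]
    by (simp add: blinfun.add_left blinfun.diff_left blinfun.scaleR_left)
  have comm': "M (A x) = A (M x)" "M (B x) = B (M x)" for x
    using arg_cong[OF comm(1), of "\<lambda>Q. blinfun_apply Q x"]
      arg_cong[OF comm(2), of "\<lambda>Q. blinfun_apply Q x"] by simp_all
  define R where "R p = (A (fst p) - B (snd p), B (fst p) + A (snd p))" for p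
  note bl = blinfun.add_right blinfun.diff_right blinfun.scaleR_right
  have "bounded_linear R"
    unfolding R_def by (intro bounded_linear_intros)
  moreover have "R (cscale c p) = cscale c (R p)" for c p
    by (simp add: R_def cscale_def bl algebra_simps)
  moreover have "R (cscale z p - complexify M p) = p" for p
    using re'[of "fst p"] re'[of "snd p"] im'[of "fst p"] im'[of "snd p"]
    by (simp add: R_def cscale_def complexify_def bl prod_eq_iff algebra_simps)
  moreover have "cscale z (R p) - complexify M (R p) = p" for p
    using re'[of "fst p"] re'[of "snd p"] im'[of "fst p"] im'[of "snd p"]
    by (simp add: R_def cscale_def complexify_def bl comm' prod_eq_iff algebra_simps)
  ultimately show ?thesis
    unfolding complex_spectrum_def by blast
qed

text \<open>Here \<open>r\<close> is the limit in Gelfand's formula, taken as the infimum of the rates \<open>t\<close> with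
  \<open>norm (M^n) = O(t^n)\<close>, so that the bounds above \<open>r\<close> and their failure below \<open>r\<close> are immediate. The
  Neumann series shows that no such rate is below the modulus of a point of the spectrum.\<close>

lemma growth_rate_of_powers:
  fixes M :: "'a::banach \<Rightarrow>\<^sub>L 'a"
  assumes "spectral_radius M > 1"
  obtains r where "1 < r"
    and "\<And>t. r < t \<Longrightarrow> \<exists>K. \<forall>n. norm (blinfun_power M n) \<le> K * t ^ n"
    and "\<And>s B. 0 < s \<Longrightarrow> s < r \<Longrightarrow> \<exists>n. B * s ^ n < norm (blinfun_power M n)"
proof -
  define S where "S = {t. 0 < t \<and> (\<exists>K. \<forall>n. norm (blinfun_power M n) \<le> K * t ^ n)}"
  define r where "r = Inf S"
  obtain z where z: "z \<in> complex_spectrum M" "1 < cmod z"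
  proof -
    obtain z where "z \<in> complex_spectrum M" "1 < ennreal (cmod z)"
      using assms unfolding spectral_radius_def less_SUP_iff by blast
    moreover from this have "1 < cmod z"
      by (metis ennreal_1 ennreal_less_iff zero_le_one)
    ultimately show ?thesis using that by blast
  qed
  have ge: "cmod z \<le> t" if "t \<in> S" for t
    using that z bounded_powers_not_in_complex_spectrum[of M _ t z]
    unfolding S_def by force
  have "norm (blinfun_power M n) \<le> 1 * (norm M + 1) ^ n" for n
    using norm_blinfun_power_le[of M n] power_mono[of "norm M" "norm M + 1" n] by simp
  then have "norm M + 1 \<in> S"
    unfolding S_def using add_nonneg_pos[of "norm M" 1] by (simp, blast)
  then have ne: "S \<noteq> {}" by blast
  have bdd: "bdd_below S" using ge by (meson bdd_belowI)
  show ?thesis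
  proof
    show "1 < r"
      using cInf_greatest[OF ne ge] z(2) unfolding r_def by linarith
    show "\<exists>K. \<forall>n. norm (blinfun_power M n) \<le> K * t ^ n" if rt: "r < t" for t
    proof -
      obtain t' where t': "t' \<in> S" "t' < t"
        using rt ne cInf_lessD unfolding r_def by blast
      then obtain K where K: "\<And>n. norm (blinfun_power M n) \<le> K * t' ^ n" and t0: "0 < t'"
        unfolding S_def by blast
      have "0 \<le> K"
        using K[of 0] by (simp add: order_trans[OF norm_ge_zero])
      then have "K * t' ^ n \<le> K * t ^ n" for n
        using t' t0 by (intro mult_left_mono power_mono) auto
      then show ?thesis using K order_trans by blast
    qed
    show "\<exists>n. B * s ^ n < norm (blinfun_power M n)" if "0 < s" "s < r" for s B
    proof (rule ccontr)
      assume "\<not> ?thesis"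
      then have "s \<in> S" using that unfolding S_def by (auto simp: not_less)
      then show False using cInf_lower[OF _ bdd] that(2) unfolding r_def by fastforce
    qed
  qed
qed

section \<open>Vectors with backward exponential decay\<close>

text \<open>The least index at which the sequence exceeds \<open>B\<close> and all its values up to \<open>n0\<close> is such a record.\<close>

lemma unbounded_sequence_record:
  fixes f :: "nat \<Rightarrow> real"
  assumes "\<And>B. \<exists>n. B < f n"
  obtains n where "n0 < n" "B < f n" "\<And>k. k \<le> n \<Longrightarrow> f k \<le> f n"
proof -
  define C where "C = Max (insert B (f ` {..n0}))"
  have C: "B \<le> C" "\<And>k. k \<le> n0 \<Longrightarrow> f k \<le> C"
    unfolding C_def by (simp, intro Max_ge, auto)
  define n where "n = (LEAST n. C < f n)"
  have n: "C < f n" unfolding n_def using assms by (rule LeastI_ex)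
  have low: "f k \<le> C" if "k < n" for k
    using not_less_Least[of k "\<lambda>n. C < f n"] that unfolding n_def by auto
  show ?thesis
  proof
    show "n0 < n" using n C(2)[of n] by (meson linorder_not_less)
    show "B < f n" using n C(1) by simp
    show "f k \<le> f n" if "k \<le> n" for k
      using that low[of k] n by (cases "k = n") auto
  qed
qed

text \<open>Substitute for an approximate eigenvector to a spectral value of modulus greater than 1: the decay
  backwards from time \<open>N\<close> makes superlinear remainders summable along the orbit, and the last bound
  keeps \<open>M^N u\<close> away from the kernel of \<open>M - id\<close>. That \<open>c\<close> precedes \<open>a\<close> and \<open>\<delta>\<close> lets a
  later choice of a small \<open>a\<close> absorb errors of order \<open>a powr \<sigma>\<close>, uniformly in \<open>\<delta>\<close>.\<close>

lemma amplified_initial_vector: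
  fixes M :: "'a::real_normed_vector \<Rightarrow>\<^sub>L 'a"
  assumes s: "1 < s" and unbounded: "\<And>B. \<exists>n. B * s ^ n < norm (blinfun_power M n)"
  obtains c where "0 < c"
    and "\<And>a \<delta>. 0 < a \<Longrightarrow> 0 < \<delta> \<Longrightarrow> \<exists>u N. 1 \<le> N \<and> norm u \<le> \<delta> \<and>
      (\<forall>n\<le>N. norm (blinfun_power M n u) \<le> a * s ^ n / s ^ N) \<and>
      c * a \<le> norm (M (blinfun_power M N u) - blinfun_power M N u)"
proof -
  \<comment> \<open>The fraction of the operator norm that the vector attains. It is less than 1, so that such a
    vector exists, but \<open>\<theta> * s > 1\<close>, so that the loss does not spoil the growth in the last step.\<close>
  define \<theta> where "\<theta> = (1 + 1 / s) / 2"
  have \<theta>: "0 < \<theta>" "\<theta> < 1" "1 < \<theta> * s"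
    using s by (auto simp: \<theta>_def field_simps)
  define c where "c = 1 - 1 / (\<theta> * s)"
  have c: "0 < c" using \<theta> by (simp add: c_def)
  have "\<exists>u N. 1 \<le> N \<and> norm u \<le> \<delta> \<and>
      (\<forall>n\<le>N. norm (blinfun_power M n u) \<le> a * s ^ n / s ^ N) \<and>
      c * a \<le> norm (M (blinfun_power M N u) - blinfun_power M N u)"
    if a: "0 < a" and \<delta>: "0 < \<delta>" for a \<delta>
  proof -
    define m where "m n = norm (blinfun_power M n)" for n
    \<comment> \<open>A record above this level stretches enough to reach size \<open>a\<close> from size \<open>\<delta>\<close>.\<close>
    define B where "B = a / (\<theta> * \<delta>)"
    have B: "0 < B" using a \<delta> \<theta> by (simp add: B_def)
    have unb: "\<exists>n. D < m n / s ^ n" for D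
      using unbounded[of D] s by (simp add: m_def field_simps)
    obtain N' where N': "1 < N'" "B < m N' / s ^ N'" "\<And>k. k \<le> N' \<Longrightarrow> m k / s ^ k \<le> m N' / s ^ N'"
      by (rule unbounded_sequence_record[OF unb, of 1 B]) blast
    \<comment> \<open>The orbit is stopped one step before the record, so that the step that follows is known to
      expand.\<close>
    define N where "N = N' - 1"
    have NN: "N' = Suc N" "1 \<le> N" using N'(1) by (auto simp: N_def)
    have mB: "B < m N'"
    proof -
      have "B * 1 \<le> B * s ^ N'" using s B by (intro mult_left_mono) auto
      also have "\<dots> < m N'" using N'(2) s by (simp add: field_simps)
      finally show ?thesis by simp
    qed
    then have mpos: "0 < m N'" using B by simp
    obtain x where x: "\<theta> * m N' * norm x < norm (blinfun_power M N' x)"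
    proof (rule ccontr)
      assume "\<not> thesis"
      then have "norm (blinfun_power M N' x) \<le> \<theta> * m N' * norm x" for x
        using that by (meson not_le)
      then have "m N' \<le> \<theta> * m N'"
        unfolding m_def using \<theta>(1) by (intro norm_blinfun_bound) auto
      then show False using mpos \<theta> by simp
    qed
    define q where "q = norm (blinfun_power M N' x)"
    have "0 \<le> \<theta> * m N' * norm x" using \<theta> mpos by simp
    then have q: "0 < q" "\<theta> * m N' * norm x < q" using x unfolding q_def by linarith+
    define u where "u = (a / q) *\<^sub>R x"
    have nu: "norm u * (\<theta> * m N') \<le> a"
      using q a by (simp add: u_def field_simps)
    have top: "norm (blinfun_power M N' u) = a"
      using q(1) a by (simp add: u_def blinfun.scaleR_right q_def[symmetric])
    have low: "norm (blinfun_power M n u) \<le> a * s ^ n / s ^ N / (\<theta> * s)" if "n \<le> N'" for n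
    proof -
      have "norm (blinfun_power M n u) \<le> m n * norm u"
        unfolding m_def by (rule norm_blinfun)
      also have "\<dots> \<le> (m N' * s ^ n / s ^ N') * norm u"
        using N'(3)[OF that] s by (intro mult_right_mono) (auto simp: field_simps)
      also have "\<dots> = norm u * (\<theta> * m N') * s ^ n / (\<theta> * s ^ N')"
        using \<theta> by simp
      also have "\<dots> \<le> a * s ^ n / (\<theta> * s ^ N')"
        using nu s \<theta> by (intro divide_right_mono mult_right_mono) auto
      finally show ?thesis by (simp add: NN mult_ac)
    qed
    have "norm u \<le> \<delta>"
    proof -
      have "a = B * \<theta> * \<delta>" using \<theta> \<delta> by (simp add: B_def)
      also have "\<dots> \<le> m N' * \<theta> * \<delta>" using mB \<theta> \<delta> by (intro mult_right_mono) auto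
      finally have "norm u * (\<theta> * m N') \<le> \<delta> * (\<theta> * m N')" using nu by (simp add: mult_ac)
      then show ?thesis using \<theta> mpos by simp
    qed
    moreover have "norm (blinfun_power M n u) \<le> a * s ^ n / s ^ N" if "n \<le> N" for n
    proof -
      have "a * s ^ n / s ^ N / (\<theta> * s) \<le> a * s ^ n / s ^ N / 1"
        using \<theta> a s by (intro divide_left_mono) auto
      then show ?thesis using low[of n] that NN by simp
    qed
    moreover have "c * a \<le> norm (M (blinfun_power M N u) - blinfun_power M N u)"
    proof -
      have "norm (blinfun_power M N u) \<le> a / (\<theta> * s)"
        using low[of N] s NN by simp
      moreover have "norm (M (blinfun_power M N u)) = a"
        using top NN by simp
      moreover have "c * a = a - a / (\<theta> * s)" by (simp add: c_def algebra_simps)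
      ultimately show ?thesis
        using norm_triangle_ineq2[of "M (blinfun_power M N u)" "blinfun_power M N u"] by linarith
    qed
    ultimately show ?thesis using NN(2) by blast
  qed
  with c show ?thesis using that by blast
qed

section \<open>Nonlinear iterates near an unstable fixed point\<close>

lemma discrete_variation_of_constants:
  fixes M :: "'a::real_normed_vector \<Rightarrow>\<^sub>L 'a"
  shows "(T ^^ n) u - blinfun_power M n u =
    (\<Sum>k<n. blinfun_power M (n - Suc k) (T ((T ^^ k) u) - M ((T ^^ k) u)))"
proof (induction n)
  case 0
  then show ?case by simp
next
  case (Suc n)
  define r where "r k = T ((T ^^ k) u) - M ((T ^^ k) u)" for k
  have "(T ^^ Suc n) u - blinfun_power M (Suc n) u = r n + M ((T ^^ n) u - blinfun_power M n u)"
    by (simp add: r_def blinfun.diff_right)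
  also have "M ((T ^^ n) u - blinfun_power M n u) = (\<Sum>k<n. blinfun_power M (Suc n - Suc k) (r k))"
    by (simp add: Suc r_def[symmetric] blinfun.sum_right Suc_diff_Suc[symmetric] del: diff_Suc_Suc)
  finally show ?case by (simp add: r_def)
qed

lemma powr_of_power: "0 < s \<Longrightarrow> (s ^ n) powr \<sigma> = (s powr \<sigma>) ^ n" for s :: real
  by (induction n) (auto simp: powr_mult)

text \<open>The quantities \<open>b n = a * s^n / s^N\<close> bound the linear orbit. As long as the orbit of \<open>T\<close> stays within
  twice that bound, the remainder at time \<open>k\<close> is at most \<open>C * (2 * b k) powr \<sigma>\<close>, a geometric sequence of
  ratio \<open>s powr \<sigma> > t\<close>. Its convolution with \<open>K * t^n\<close> is at most a multiple of its value at time
  \<open>n\<close>, which gives \<open>\<Lambda>\<close>.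
  Since \<open>\<sigma> > 1\<close>, this error is below \<open>b n\<close> for small \<open>a\<close>, which preserves the factor 2.\<close>

lemma iterates_shadow_linearization:
  fixes M :: "'a::real_normed_vector \<Rightarrow>\<^sub>L 'a"
  assumes bound: "\<And>n. norm (blinfun_power M n) \<le> K * t ^ n"
    and t: "0 < t" "t < s powr \<sigma>" and s: "1 < s" and \<sigma>: "1 < \<sigma>"
    and rem: "\<And>x. norm x < \<rho> \<Longrightarrow> norm (T x - M x) \<le> C * norm x powr \<sigma>" and C: "0 \<le> C"
    and \<Lambda>: "\<Lambda> = K * C * 2 powr \<sigma> / (s powr \<sigma> - t)"
    and a: "0 < a" "2 * a < \<rho>" "\<Lambda> * a powr (\<sigma> - 1) \<le> 1"
    and lin: "\<And>n. n \<le> N \<Longrightarrow> norm (blinfun_power M n u) \<le> a * s ^ n / s ^ N"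
    and n: "n \<le> N"
  shows "norm ((T ^^ n) u - blinfun_power M n u) \<le> \<Lambda> * (a * s ^ n / s ^ N) powr \<sigma>"
    and "norm ((T ^^ n) u) \<le> 2 * a"
proof -
  define b where "b n = a * s ^ n / s ^ N" for n
  define S where "S = s powr \<sigma>"
  have K: "0 \<le> K" using order_trans[OF norm_ge_zero bound[of 0]] by simp
  have S: "t < S" "0 < S" using t s by (auto simp: S_def)
  have \<Lambda>0: "0 \<le> \<Lambda>" using K C t by (simp add: \<Lambda>)
  have b: "0 < b n" for n using a s by (simp add: b_def)
  have ba: "b n \<le> a" if "n \<le> N" for n
    using a s that power_increasing[of n N s] by (simp add: b_def field_simps)
  have bpowr: "b n powr \<sigma> = a powr \<sigma> * S ^ n / S ^ N" for n
    using a s by (simp add: b_def S_def powr_mult powr_divide powr_of_power)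
  have main: "norm ((T ^^ n) u - blinfun_power M n u) \<le> \<Lambda> * b n powr \<sigma> \<and> norm ((T ^^ n) u) \<le> 2 * b n"
    if "n \<le> N" for n
    using that
  proof (induction n rule: less_induct)
    case (less n)
    have r: "norm (T ((T ^^ k) u) - M ((T ^^ k) u)) \<le> C * (2 powr \<sigma> * b k powr \<sigma>)" if "k < n" for k
    proof -
      have k: "norm ((T ^^ k) u) \<le> 2 * b k" "k \<le> N" using less that by auto
      then have "norm ((T ^^ k) u) < \<rho>" using ba[of k] a by linarith
      then have "norm (T ((T ^^ k) u) - M ((T ^^ k) u)) \<le> C * norm ((T ^^ k) u) powr \<sigma>"
        by (rule rem)
      also have "\<dots> \<le> C * (2 * b k) powr \<sigma>"
        using k \<sigma> C by (intro mult_left_mono powr_mono2) auto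
      finally show ?thesis using b[of k] by (simp add: powr_mult)
    qed
    have "norm ((T ^^ n) u - blinfun_power M n u) \<le>
      (\<Sum>k<n. norm (blinfun_power M (n - Suc k) (T ((T ^^ k) u) - M ((T ^^ k) u))))"
      unfolding discrete_variation_of_constants by (rule norm_sum)
    also have "\<dots> \<le> (\<Sum>k<n. (K * t ^ (n - Suc k)) * (C * (2 powr \<sigma> * b k powr \<sigma>)))"
    proof (rule sum_mono)
      fix k assume "k \<in> {..<n}"
      then have "norm (blinfun_power M (n - Suc k)) * norm (T ((T ^^ k) u) - M ((T ^^ k) u))
        \<le> (K * t ^ (n - Suc k)) * (C * (2 powr \<sigma> * b k powr \<sigma>))"
        using r bound K t by (intro mult_mono) auto
      then show "norm (blinfun_power M (n - Suc k) (T ((T ^^ k) u) - M ((T ^^ k) u)))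
        \<le> (K * t ^ (n - Suc k)) * (C * (2 powr \<sigma> * b k powr \<sigma>))"
        by (rule order_trans[OF norm_blinfun])
    qed
    also have "\<dots> = K * C * 2 powr \<sigma> * a powr \<sigma> / S ^ N * (\<Sum>k<n. t ^ (n - Suc k) * S ^ k)"
      by (simp add: bpowr sum_distrib_left sum_divide_distrib mult_ac)
    also have "\<dots> \<le> K * C * 2 powr \<sigma> * a powr \<sigma> / S ^ N * (S ^ n / (S - t))"
    proof (rule mult_left_mono)
      have "(S - t) * (\<Sum>k<n. t ^ (n - Suc k) * S ^ k) = S ^ n - t ^ n"
        by (simp add: power_diff_sumr2)
      also have "\<dots> \<le> S ^ n" using t by simp
      finally show "(\<Sum>k<n. t ^ (n - Suc k) * S ^ k) \<le> S ^ n / (S - t)"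
        using S by (simp add: field_simps)
    qed (use K C S in auto)
    also have "\<dots> = \<Lambda> * b n powr \<sigma>" by (simp add: \<Lambda> S_def[symmetric] bpowr mult_ac)
    finally have e: "norm ((T ^^ n) u - blinfun_power M n u) \<le> \<Lambda> * b n powr \<sigma>" .
    have "\<Lambda> * b n powr \<sigma> = \<Lambda> * b n powr (\<sigma> - 1) * b n"
      using b[of n] by (simp add: powr_diff)
    also have "\<dots> \<le> \<Lambda> * a powr (\<sigma> - 1) * b n"
      using b[of n] ba[OF less.prems] \<Lambda>0 \<sigma> by (intro mult_right_mono mult_left_mono powr_mono2) auto
    also have "\<dots> \<le> 1 * b n" using a b[of n] by (intro mult_right_mono) auto
    finally have "norm ((T ^^ n) u - blinfun_power M n u) \<le> b n" using e by simp
    then have "norm ((T ^^ n) u) \<le> 2 * b n"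
      using lin[OF less.prems] norm_triangle_sub[of "(T ^^ n) u" "blinfun_power M n u"]
      unfolding b_def[symmetric] by linarith
    with e show ?case by blast
  qed
  show "norm ((T ^^ n) u - blinfun_power M n u) \<le> \<Lambda> * (a * s ^ n / s ^ N) powr \<sigma>"
    and "norm ((T ^^ n) u) \<le> 2 * a"
    using main[OF n] ba[OF n] unfolding b_def by linarith+
qed

text \<open>The operator \<open>L = M - id\<close> serves as a test for the distance to fixed points: it is of order \<open>a\<close> on
  \<open>T^N u\<close>, but of order \<open>a powr \<sigma>\<close> on fixed points of size at most \<open>4 * a\<close>.\<close>

theorem orbital_instability_of_fixed_points:
  fixes V E :: "'a::banach set" and M :: "'a \<Rightarrow>\<^sub>L 'a"
  assumes V: "open V" "0 \<in> V" and E: "0 \<in> E" "\<And>u. u \<in> E \<Longrightarrow> T u = u"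
    and rad: "spectral_radius M > 1" and \<sigma>: "\<sigma> > 1"
    and bigo: "(\<lambda>u. norm (T u - blinfun_apply M u)) \<in> O[at 0](\<lambda>u. norm u powr \<sigma>)"
  shows "\<exists>\<epsilon>0>0. \<forall>\<delta>>0. \<exists>u\<in>V. norm u \<le> \<delta> \<and>
    (\<exists>N\<ge>1. (\<forall>n\<in>{1..N}. (T ^^ n) u \<in> V) \<and> infdist ((T ^^ N) u) E \<ge> \<epsilon>0)"
proof -
  obtain C \<rho> where C: "0 < C" and \<rho>: "0 < \<rho>" and \<rho>V: "\<And>x. norm x < \<rho> \<Longrightarrow> x \<in> V"
    and rem: "\<And>x. norm x < \<rho> \<Longrightarrow> norm (T x - M x) \<le> C * norm x powr \<sigma>"
  proof -
    obtain C where C: "0 < C" and ev: "\<forall>\<^sub>F x in at 0. norm (T x - M x) \<le> C * norm x powr \<sigma>"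
      using landau_o.bigE[OF bigo] by auto
    obtain d where d: "0 < d" "\<And>x. x \<noteq> 0 \<Longrightarrow> norm x < d \<Longrightarrow> norm (T x - M x) \<le> C * norm x powr \<sigma>"
      using ev unfolding eventually_at by (auto simp: dist_norm)
    obtain d' where d': "0 < d'" "ball 0 d' \<subseteq> V"
      using V open_contains_ball by blast
    show ?thesis
    proof
      show "norm (T x - M x) \<le> C * norm x powr \<sigma>" if "norm x < min d d'" for x
        using d(2)[of x] that E(2)[OF E(1)] by (cases "x = 0") auto
      show "x \<in> V" if "norm x < min d d'" for x
        using that d'(2) by (auto simp: subset_iff)
    qed (use C d d' in auto)
  qed
  obtain r where r: "1 < r"
    "\<And>t. r < t \<Longrightarrow> \<exists>K. \<forall>n. norm (blinfun_power M n) \<le> K * t ^ n"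
    "\<And>s B. 0 < s \<Longrightarrow> s < r \<Longrightarrow> \<exists>n. B * s ^ n < norm (blinfun_power M n)"
    by (rule growth_rate_of_powers[OF rad]) blast
  obtain s t where st: "1 < s" "s < r" "r < t" "t < s powr \<sigma>"
  proof -
    \<comment> \<open>Rates \<open>s\<close> above \<open>r powr (1 / \<sigma>)\<close> satisfy \<open>r < s powr \<sigma>\<close>, which leaves room for \<open>t\<close>.\<close>
    define q where "q = max 1 (r powr (1 / \<sigma>))"
    have "r powr (1 / \<sigma>) < r powr 1" using r(1) \<sigma> by (intro powr_less_mono) auto
    then have "q < r" using r(1) by (simp add: q_def)
    then obtain s where s: "q < s" "s < r" using dense by blast
    have "(r powr (1 / \<sigma>)) powr \<sigma> < s powr \<sigma>"
      using s \<sigma> by (intro powr_less_mono2) (auto simp: q_def)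
    then have "r < s powr \<sigma>" using \<sigma> r(1) by (simp add: powr_powr)
    then obtain t where "r < t" "t < s powr \<sigma>" using dense by blast
    then show ?thesis using that[of s t] s unfolding q_def by (metis max_less_iff_conj)
  qed
  obtain K where K: "\<And>n. norm (blinfun_power M n) \<le> K * t ^ n" using r(2)[OF st(3)] by blast
  obtain c where c: "0 < c" and amplified:
    "\<And>a \<delta>. 0 < a \<Longrightarrow> 0 < \<delta> \<Longrightarrow> \<exists>u N. 1 \<le> N \<and> norm u \<le> \<delta> \<and>
      (\<forall>n\<le>N. norm (blinfun_power M n u) \<le> a * s ^ n / s ^ N) \<and>
      c * a \<le> norm (M (blinfun_power M N u) - blinfun_power M N u)"
  proof (rule amplified_initial_vector[OF st(1), of M])
    show "\<exists>n. B * s ^ n < norm (blinfun_power M n)" for B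
      using r(3)[of s B] st by simp
  qed (rule that)
  define \<Lambda> where "\<Lambda> = K * C * 2 powr \<sigma> / (s powr \<sigma> - t)"
  define L where "L = M - id_blinfun"
  have L: "L x = M x - x" for x by (simp add: L_def blinfun.diff_left)
  \<comment> \<open>Adding 1 makes \<open>D\<close> positive, so that it may be divided by, even when \<open>L\<close> is zero.\<close>
  define D where "D = norm L + 1"
  have D: "0 < D" "norm (L x) \<le> D * norm x" for x
    using norm_blinfun[of L x] add_nonneg_pos[of "norm L" 1]
    by (auto simp: D_def algebra_simps intro: order_trans)
  \<comment> \<open>The coefficient of the total error \<open>G * a powr \<sigma>\<close>: \<open>D * \<Lambda>\<close> from shadowing the linear orbit,
    \<open>C * 4 powr \<sigma>\<close> from the fixed points.\<close>
  define G where "G = D * \<Lambda> + C * 4 powr \<sigma>"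
  obtain a where a: "0 < a" "4 * a < \<rho>" "\<Lambda> * a powr (\<sigma> - 1) \<le> 1" "G * a powr (\<sigma> - 1) \<le> c / 2"
  proof -
    have lim: "((\<lambda>a. B * a powr (\<sigma> - 1)) \<longlongrightarrow> 0) (at_right 0)" for B :: real
      using \<sigma> by real_asymp
    have lim4: "((\<lambda>a::real. 4 * a) \<longlongrightarrow> 0) (at_right 0)" by real_asymp
    have "\<forall>\<^sub>F a in at_right 0. 0 < a \<and> 4 * a < \<rho> \<and> \<Lambda> * a powr (\<sigma> - 1) < 1 \<and> G * a powr (\<sigma> - 1) < c / 2"
      using c \<rho> by (intro eventually_conj eventually_at_right_less order_tendstoD(2)[OF lim] order_tendstoD(2)[OF lim4]) auto
    then obtain a where "0 < a \<and> 4 * a < \<rho> \<and> \<Lambda> * a powr (\<sigma> - 1) < 1 \<and> G * a powr (\<sigma> - 1) < c / 2"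
      using eventually_happens'[OF trivial_limit_at_right_real] by blast
    then show ?thesis using that by force
  qed
  define \<epsilon> where "\<epsilon> = min (2 * a) (c * a / (2 * D))"
  have "\<exists>u\<in>V. norm u \<le> \<delta> \<and>
    (\<exists>N\<ge>1. (\<forall>n\<in>{1..N}. (T ^^ n) u \<in> V) \<and> \<epsilon> \<le> infdist ((T ^^ N) u) E)" if \<delta>: "0 < \<delta>" for \<delta>
  proof -
    obtain u N where N: "1 \<le> N" and u: "norm u \<le> \<delta>"
      and lin: "\<And>n. n \<le> N \<Longrightarrow> norm (blinfun_power M n u) \<le> a * s ^ n / s ^ N"
      and big: "c * a \<le> norm (L (blinfun_power M N u))"
      using amplified[OF a(1) \<delta>] unfolding L by blast
    have a2: "2 * a < \<rho>" using a by simp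
    have t0: "0 < t" using r st by simp
    note shadow = iterates_shadow_linearization[OF K t0 st(4) st(1) \<sigma> rem less_imp_le[OF C] \<Lambda>_def a(1) a2 a(3) lin]
    have inV: "(T ^^ n) u \<in> V" if "n \<le> N" for n
      using shadow(2)[OF _ _ that] a2 by (intro \<rho>V) auto
    define w where "w = (T ^^ N) u"
    have w: "norm w \<le> 2 * a" using shadow(2)[of N] by (simp add: w_def)
    have wM: "norm (w - blinfun_power M N u) \<le> \<Lambda> * a powr \<sigma>"
      using shadow(1)[of N] st by (simp add: w_def)
    have "\<epsilon> \<le> dist w p" if p: "p \<in> E" for p
    proof (cases "norm p \<le> 4 * a")
      case False
      then have "2 * a \<le> dist w p"
        using w norm_triangle_ineq2[of p w] by (simp add: dist_norm norm_minus_commute)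
      then show ?thesis by (simp add: \<epsilon>_def)
    next
      case True
      have "norm (L p) = norm (T p - M p)"
        using E(2)[OF p] by (simp add: L norm_minus_commute)
      also have "\<dots> \<le> C * norm p powr \<sigma>" using True a by (intro rem) auto
      also have "\<dots> \<le> C * (4 * a) powr \<sigma>"
        using True C \<sigma> by (intro mult_left_mono powr_mono2) auto
      finally have Lp: "norm (L p) \<le> C * 4 powr \<sigma> * a powr \<sigma>" using a by (simp add: powr_mult)
      have "norm (L (w - blinfun_power M N u)) \<le> D * (\<Lambda> * a powr \<sigma>)"
        using D(2)[of "w - blinfun_power M N u"] mult_left_mono[OF wM, of D] D(1) by linarith
      moreover have "L (blinfun_power M N u) = L (w - p) + L p - L (w - blinfun_power M N u)"
        by (simp add: blinfun.diff_right)
      then have "norm (L (blinfun_power M N u))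
        \<le> norm (L (w - p)) + norm (L p) + norm (L (w - blinfun_power M N u))"
        using norm_triangle_ineq[of "L (w - p)" "L p"]
          norm_triangle_ineq4[of "L (w - p) + L p" "L (w - blinfun_power M N u)"] by simp
      moreover have "D * (\<Lambda> * a powr \<sigma>) + C * 4 powr \<sigma> * a powr \<sigma> = G * a powr (\<sigma> - 1) * a"
        using a by (simp add: G_def powr_diff algebra_simps)
      moreover have "G * a powr (\<sigma> - 1) * a \<le> c / 2 * a"
        using a by (intro mult_right_mono) auto
      ultimately have "c * a / 2 \<le> norm (L (w - p))" using Lp big by linarith
      also have "\<dots> \<le> D * norm (w - p)" by (rule D)
      finally have "c * a / (2 * D) \<le> dist w p" using D by (simp add: dist_norm field_simps)
      then show ?thesis by (simp add: \<epsilon>_def)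
    qed
    then have "\<epsilon> \<le> infdist w E"
      using E(1) unfolding infdist_def by (auto intro: cINF_greatest)
    then show ?thesis
      using inV[of 0] inV u N unfolding w_def by (intro bexI[of _ u] conjI exI[of _ N]) auto
  qed
  moreover have "0 < \<epsilon>" using a c D by (simp add: \<epsilon>_def)
  ultimately show ?thesis by blast
qed

theorem lemma5p4:
  fixes V E :: "'a::banach set"
    and U :: "(real ^ 'm) set"
    and \<psi> :: "real ^ 'm \<Rightarrow> 'a"
    and T :: "'a \<Rightarrow> 'a"
    and M :: "'a \<Rightarrow>\<^sub>L 'a"
    and \<sigma> :: real
  assumes "open V" and "0 \<in> V"
    and "E \<subseteq> V" and "0 \<in> E"
    and "C2_parametrized_manifold \<psi> U E"
    and "inj_on \<psi> U" and "\<psi> 0 = 0"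
    and "dim (range (frechet_derivative \<psi> (at 0))) = CARD('m)"
    and "continuous_on V T"
    and "\<And>u. u \<in> E \<Longrightarrow> T u = u"
    and "spectral_radius M > 1"
    and "\<sigma> > 1"
    and "(\<lambda>u. norm (T u - blinfun_apply M u)) \<in> O[at 0](\<lambda>u. norm u powr \<sigma>)"
    and "\<And>i. partial_derivative i \<psi> 0 \<in> {v. blinfun_apply (M - id_blinfun) v = 0}"
  shows "\<exists>\<epsilon>0>0. \<forall>\<delta>>0. \<exists>u\<in>V. norm u \<le> \<delta> \<and>
    (\<exists>N\<ge>1. (\<forall>n\<in>{1..N}. (T ^^ n) u \<in> V) \<and> infdist ((T ^^ N) u) E \<ge> \<epsilon>0)"
  using orbital_instability_of_fixed_points[OF assms(1,2,4,10,11,12,13)] .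

end
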